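(* There is a $\frac{4}{3}$-competitive online algorithm with advice for multi-coloring hexagonal graphs $G=(V,E)$ with advice complexity at most $n+2|V|$, where $n$ is the number of requests.
   Context: A hexagonal graph is a graph obtained by placing at most one node in each cell of a hexagonal grid and adding an edge between every pair of nodes in neighboring cells. Online multi-coloring: the graph is known in advance; requests arrive one at a time, each naming a node $v$, and must immediately and irrevocably receive a color (positive integer) different from every color previously assigned to $v$ or any neighbor of $v$. $A(I)$ is the number of colors used and $\mathrm{Opt}(I)$ the minimum number an offline algorithm needs. Advice model: an all-powerful oracle knowing $I$ writes an infinite binary advice tape; advice complexity is the maximum index of a bit read. $A$ is $c$-competitive if there is a constant $\alpha$ with $A(I)\le c\cdot\mathrm{Opt}(I)+\alpha$ for all $I$. *)

theory Defs
  imports Complex_Main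
begin

text \<open>
  The hexagonal grid in axial coordinates: the cells are indexed by pairs of integers, and each
  cell has six neighbors.
\<close>

definition neighboring_cells :: "int \<times> int \<Rightarrow> int \<times> int \<Rightarrow> bool" where
  "neighboring_cells c d \<longleftrightarrow>
     (fst d - fst c, snd d - snd c) \<in> {(1, 0), (-1, 0), (0, 1), (0, -1), (1, -1), (-1, 1)}"

type_synonym 'v graph = "'v set \<times> 'v set set"

definition hexagonal_graph :: "'v graph \<Rightarrow> bool" where
  "hexagonal_graph G \<longleftrightarrow> (case G of (V, E) \<Rightarrow>
     finite V \<and>
     (\<exists>cell. inj_on cell V \<and>
       E = {{u, v} | u v. u \<in> V \<and> v \<in> V \<and> neighboring_cells (cell u) (cell v)}))"

text \<open>
  A request sequence is a list of nodes, and \<open>cs ! i\<close> is the color given to the \<open>i\<close>-th request.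
\<close>

definition proper_multicoloring :: "'v graph \<Rightarrow> 'v list \<Rightarrow> nat list \<Rightarrow> bool" where
  "proper_multicoloring G I cs \<longleftrightarrow>
     length cs = length I \<and>
     (\<forall>i < length I. 0 < cs ! i) \<and>
     (\<forall>j < length I. \<forall>i < j.
        I ! i = I ! j \<or> {I ! i, I ! j} \<in> snd G \<longrightarrow> cs ! i \<noteq> cs ! j)"

definition opt :: "'v graph \<Rightarrow> 'v list \<Rightarrow> nat" where
  "opt G I = (LEAST k. \<exists>cs. proper_multicoloring G I cs \<and> card (set cs) = k)"

type_synonym tape = "nat \<Rightarrow> bool"

text \<open>
  A computation with access to the advice tape is a decision tree: \<open>Read i f\<close> inspects tape cell
  \<open>i\<close> and continues with \<open>f\<close> applied to the bit found there. Since \<open>tape\<close> is indexed from 0, cell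
  \<open>i\<close> holds the bit with index \<open>Suc i\<close>; \<open>max_read\<close> is the largest such index, or 0 if no bit is
  read.
\<close>

datatype 'a advised = Return 'a | Read nat "bool \<Rightarrow> 'a advised"

primrec run :: "tape \<Rightarrow> 'a advised \<Rightarrow> 'a" where
  "run \<phi> (Return x) = x"
| "run \<phi> (Read i f) = run \<phi> (f (\<phi> i))"

primrec max_read :: "tape \<Rightarrow> 'a advised \<Rightarrow> nat" where
  "max_read \<phi> (Return x) = 0"
| "max_read \<phi> (Read i f) = max (Suc i) (max_read \<phi> (f (\<phi> i)))"

text \<open>
  The algorithm knows the graph and the requests up to and including the current one. It carries
  no explicit state: it is deterministic and may reread the tape, so earlier bits and colors can
  be recomputed, and rereading does not change the largest index read.
\<close>

type_synonym 'v online_algorithm = "'v graph \<Rightarrow> 'v list \<Rightarrow> nat advised"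

type_synonym 'v oracle_fun = "'v graph \<Rightarrow> 'v list \<Rightarrow> tape"

definition online_colors ::
    "'v online_algorithm \<Rightarrow> 'v oracle_fun \<Rightarrow> 'v graph \<Rightarrow> 'v list \<Rightarrow> nat list" where
  "online_colors A orc G I =
     map (\<lambda>i. run (orc G I) (A G (take (Suc i) I))) [0..<length I]"

definition advice_complexity ::
    "'v online_algorithm \<Rightarrow> 'v oracle_fun \<Rightarrow> 'v graph \<Rightarrow> 'v list \<Rightarrow> nat" where
  "advice_complexity A orc G I =
     Max (insert 0 ((\<lambda>i. max_read (orc G I) (A G (take (Suc i) I))) ` {..<length I}))"

definition multicolors ::
    "'v graph set \<Rightarrow> 'v online_algorithm \<Rightarrow> 'v oracle_fun \<Rightarrow> bool" where
  "multicolors \<G> A orc \<longleftrightarrow>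
     (\<forall>G \<in> \<G>. \<forall>I \<in> lists (fst G). proper_multicoloring G I (online_colors A orc G I))"

text \<open>The additive constant depends neither on the request sequence nor on the graph.\<close>

definition competitive ::
    "'v graph set \<Rightarrow> real \<Rightarrow> 'v online_algorithm \<Rightarrow> 'v oracle_fun \<Rightarrow> bool" where
  "competitive \<G> c A orc \<longleftrightarrow>
     (\<exists>\<alpha>::real. \<forall>G \<in> \<G>. \<forall>I \<in> lists (fst G).
        real (card (set (online_colors A orc G I))) \<le> c * real (opt G I) + \<alpha>)"

end

theory Submission
  imports Defs
begin

text \<open>
  Put \<open>K = opt div 3 + 1\<close>, so that any three mutually adjacent cells receive fewer than \<open>3 K\<close>
  requests in total. Three-color the grid so that a positive direction leads from class \<open>c\<close> to class
  \<open>c + 1\<close>, and use three base palettes and a fourth one, each of size \<open>K\<close>. A cell first uses the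
  palette of its own class bottom-up; then it borrows, top-down, those colors of the palette of the
  next class which none of its positive neighbors needs; finally it uses the fourth palette. Cells
  that reach the fourth palette induce a forest: each of them has at most one such negative
  neighbor, and if it also has such a positive neighbor, then the two lie opposite each other. So
  the components are unions of straight rays from a common root, and they can be 2-colored; one
  side uses the fourth palette bottom-up and the other one top-down.

  The request bits announce when a node changes the palette. A node that leaves its own palette has
  seen \<open>K\<close> requests and thereby knows \<open>K\<close>. Two bits per node give its side in the 2-coloring and
  whether it skips the borrowing phase.
\<close>

section \<open>Weights on the hexagonal grid\<close>

definition pos_dirs :: "(int \<times> int) set" where
  "pos_dirs = {(1, 0), (0, -1), (-1, 1)}"

definition shift :: "int \<times> int \<Rightarrow> int \<times> int \<Rightarrow> int \<Rightarrow> int \<times> int" where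
  "shift p d n = (fst p + n * fst d, snd p + n * snd d)"

definition cell_class :: "int \<times> int \<Rightarrow> nat" where
  "cell_class p = nat ((fst p - snd p) mod 3)"

lemma shift_shift [simp]: "shift (shift p d m) d n = shift p d (m + n)"
  by (simp add: shift_def algebra_simps)

lemma shift_0 [simp]: "shift p d 0 = p"
  by (simp add: shift_def)

lemma cell_class_less: "cell_class p < 3"
  by (simp add: cell_class_def nat_less_iff)

lemma cell_class_shift:
  assumes "d \<in> pos_dirs"
  shows "cell_class (shift p d 1) = (cell_class p + 1) mod 3"
proof -
  have "fst d - snd d \<in> {1, -2}"
    using assms by (auto simp: pos_dirs_def)
  then have "(fst d - snd d) mod 3 = 1"
    by auto
  then have "(fst p - snd p + (fst d - snd d)) mod 3 = ((fst p - snd p) mod 3 + 1) mod 3"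
    by (metis mod_add_eq mod_add_left_eq)
  moreover have "fst p + fst d - (snd p + snd d) = fst p - snd p + (fst d - snd d)"
    by simp
  ultimately have "cell_class (shift p d 1) = nat (((fst p - snd p) mod 3 + 1) mod 3)"
    unfolding cell_class_def shift_def fst_conv snd_conv mult_1 by metis
  also have "\<dots> = (cell_class p + 1) mod 3"
    unfolding cell_class_def by (subst nat_mod_distrib) (simp_all add: nat_add_distrib)
  finally show ?thesis .
qed

lemma neighboring_cells_iff:
  "neighboring_cells p q \<longleftrightarrow> (\<exists>d\<in>pos_dirs. q = shift p d 1 \<or> p = shift q d 1)"
proof -
  obtain a b where p: "p = (a, b)"
    by fastforce
  obtain x y where q: "q = (a + x, b + y)"
    by (metis add.commute diff_add_cancel surj_pair)
  have "(a = a + x + i) = (x = - i)" "(b = b + y + i) = (y = - i)" for i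
    by auto
  then show ?thesis
    unfolding p q by (auto simp: neighboring_cells_def pos_dirs_def shift_def)
qed

lemma neighboring_cells_sym: "neighboring_cells p q \<longleftrightarrow> neighboring_cells q p"
  unfolding neighboring_cells_iff by blast

text \<open>The three positive directions sum to zero, so the negated sum of \<open>d\<close> and
  \<open>d'\<close> is the third one, and it leads from \<open>shift p d 1\<close> to
  \<open>shift p d' (-1)\<close>.\<close>

lemma neighboring_cells_triangle:
  assumes "d \<in> pos_dirs" "d' \<in> pos_dirs" "d \<noteq> d'"
  shows "neighboring_cells p (shift p d 1)" "neighboring_cells p (shift p d' (-1))"
    "neighboring_cells (shift p d 1) (shift p d' (-1))"
proof -
  have "p = shift (shift p d' (-1)) d' 1"
    by simp
  then show "neighboring_cells p (shift p d 1)" "neighboring_cells p (shift p d' (-1))"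
    unfolding neighboring_cells_iff using assms by blast+
  have "fst (shift p d' (-1)) - fst (shift p d 1) = - fst d' - fst d"
    "snd (shift p d' (-1)) - snd (shift p d 1) = - snd d' - snd d"
    by (simp_all add: shift_def)
  moreover have "(- fst d' - fst d, - snd d' - snd d) \<in> {(1, 0), (0, -1), (-1, 1)}"
    using assms unfolding pos_dirs_def by auto
  ultimately show "neighboring_cells (shift p d 1) (shift p d' (-1))"
    unfolding neighboring_cells_def by auto
qed

lemma cell_class_neq_of_neighboring:
  assumes "neighboring_cells p q"
  shows "cell_class p \<noteq> cell_class q"
proof -
  have "(c + 1) mod 3 \<noteq> c" for c :: nat
    by presburger
  then show ?thesis
    using assms by (metis cell_class_shift neighboring_cells_iff)
qed

section \<open>Palettes, borrowing and the offline coloring\<close>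

definition palette_color :: "nat \<Rightarrow> nat \<Rightarrow> nat" where
  "palette_color a i = Suc (4 * i + a)"

lemma palette_color_inject:
  assumes "a < 4" "b < 4"
  shows "palette_color a i = palette_color b j \<longleftrightarrow> a = b \<and> i = j"
proof
  assume eq: "palette_color a i = palette_color b j"
  have "a = (4 * i + a) mod 4" "b = (4 * j + b) mod 4"
    using assms by simp_all
  with eq have "a = b"
    by (simp add: palette_color_def)
  with eq show "a = b \<and> i = j"
    by (simp add: palette_color_def)
qed simp

text \<open>Here \<open>c\<close> is the class, \<open>s\<close> the side, \<open>k\<close> the
  palette size, \<open>m\<close> the number of borrowed colors and \<open>j\<close> the number of
  earlier requests to the cell. Interleaving the palettes modulo 4 makes an own color independent of
  \<open>k\<close>; a borrowed color is independent of \<open>m\<close>. The online decoding relies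
  on both.\<close>

definition request_color :: "nat \<Rightarrow> bool \<Rightarrow> nat \<Rightarrow> nat \<Rightarrow> nat \<Rightarrow> nat" where
  "request_color c s k m j =
    (if j < k then palette_color c j
     else if j < k + m then palette_color ((c + 1) mod 3) (k - 1 - (j - k))
     else palette_color 3 (if s then j - k - m else k - 1 - (j - k - m)))"

text \<open>All positive neighbors have the next class and fill that palette from below, so the
  heaviest of them decides how much stays free at the top. Truncation yields 0 when it needs the
  whole palette.\<close>

definition spare :: "(int \<times> int \<Rightarrow> nat) \<Rightarrow> nat \<Rightarrow> int \<times> int \<Rightarrow> nat" where
  "spare W K p = K - Max ((\<lambda>d. W (shift p d 1)) ` pos_dirs)"

definition residual :: "(int \<times> int \<Rightarrow> nat) \<Rightarrow> nat \<Rightarrow> (int \<times> int) set" where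
  "residual W K = {p. K + spare W K p < W p}"

definition run_length :: "(int \<times> int) set \<Rightarrow> int \<times> int \<Rightarrow> int \<times> int \<Rightarrow> nat" where
  "run_length R d p = (LEAST n. shift p d (- int (Suc n)) \<notin> R)"

text \<open>At most one summand is nonzero for a residual cell with a residual neighbor.\<close>

definition side :: "(int \<times> int \<Rightarrow> nat) \<Rightarrow> nat \<Rightarrow> int \<times> int \<Rightarrow> bool" where
  "side W K p \<longleftrightarrow> even (\<Sum>d\<in>pos_dirs. run_length (residual W K) d p)"

definition cell_color :: "(int \<times> int \<Rightarrow> nat) \<Rightarrow> nat \<Rightarrow> int \<times> int \<Rightarrow> nat \<Rightarrow> nat" where
  "cell_color W K p j = request_color (cell_class p) (side W K p) K (spare W K p) j"

lemma finite_pos_dirs [simp]: "finite pos_dirs"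
  by (simp add: pos_dirs_def)

lemma run_length_eq_0: "shift p d (-1) \<notin> R \<Longrightarrow> run_length R d p = 0"
  by (simp add: run_length_def Least_eq_0)

text \<open>Since \<open>R\<close> is finite, the ray behind \<open>p\<close> leaves it, so the
  least number is attained.\<close>

lemma run_length_shift:
  assumes "finite R" "d \<in> pos_dirs" "p \<in> R"
  shows "run_length R d (shift p d 1) = Suc (run_length R d p)"
proof -
  have "inj (\<lambda>n. shift p d (- int n))"
    using assms(2) by (auto simp: inj_def pos_dirs_def shift_def)
  then have "\<not> range (\<lambda>n. shift p d (- int n)) \<subseteq> R"
    using assms(1) by (meson finite_imageD finite_subset infinite_UNIV_nat)
  then obtain n where n: "shift p d (- int n) \<notin> R"
    by blast
  define P where "P n \<longleftrightarrow> shift p d (- int n) \<notin> R" for n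
  have "(LEAST n. P n) = Suc (LEAST n. P (Suc n))"
    by (rule Least_Suc[of P n]) (use n assms(3) in \<open>auto simp: P_def\<close>)
  moreover have "1 + - int (Suc n) = - int n" for n
    by simp
  ultimately show ?thesis
    unfolding run_length_def P_def shift_shift by presburger
qed

lemma exists_in_pos_dirs_except: "\<exists>d'\<in>pos_dirs. d' \<noteq> d"
  by (auto simp: pos_dirs_def)

section \<open>Weight bounds and the 2-coloring of residual cells\<close>

locale grid_weights =
  fixes W :: "int \<times> int \<Rightarrow> nat" and K :: nat
  assumes finite_support: "finite {p. W p \<noteq> 0}"
    and triangle: "\<lbrakk>d \<in> pos_dirs; d' \<in> pos_dirs; d \<noteq> d'\<rbrakk>
      \<Longrightarrow> W p + W (shift p d 1) + W (shift p d' (-1)) < 3 * K"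
begin

lemma edge: "neighboring_cells p q \<Longrightarrow> W p + W q < 3 * K"
proof -
  have *: "W p + W (shift p d 1) < 3 * K" if "d \<in> pos_dirs" for p d
    using exists_in_pos_dirs_except[of d] triangle[OF that, of _ p] by fastforce
  assume "neighboring_cells p q"
  then show ?thesis
    using * by (metis neighboring_cells_iff add.commute)
qed

lemma spare_le: "d \<in> pos_dirs \<Longrightarrow> spare W K p \<le> K - W (shift p d 1)"
  unfolding spare_def by (intro diff_le_mono2 Max_ge) auto

lemma spare_attained:
  obtains d where "d \<in> pos_dirs" "spare W K p = K - W (shift p d 1)"
proof -
  have "Max ((\<lambda>d. W (shift p d 1)) ` pos_dirs) \<in> (\<lambda>d. W (shift p d 1)) ` pos_dirs"
    by (intro Max_in) (auto simp: pos_dirs_def)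
  then show ?thesis
    using that by (auto simp: spare_def)
qed

lemma finite_residual: "finite (residual W K)"
  by (rule finite_subset[OF _ finite_support]) (auto simp: residual_def)

text \<open>Hence the requests left after the first two phases fit into the fourth palette. The
  bound comes from the edge to the positive neighbor that determines \<open>spare\<close>.\<close>

lemma weight_le: "W p \<le> 2 * K + spare W K p"
proof -
  obtain d where d: "d \<in> pos_dirs" "spare W K p = K - W (shift p d 1)"
    using spare_attained by blast
  then have "W p + W (shift p d 1) < 3 * K"
    using edge neighboring_cells_iff by blast
  then show ?thesis
    using d by linarith
qed

text \<open>If \<open>e\<close> attains \<open>spare\<close>, then \<open>p\<close> and
  \<open>shift p e 1\<close> together weigh more than \<open>2 * K\<close>. A residual negative
  neighbor in a direction other than \<open>e\<close> would complete a triangle of weight above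
  \<open>3 * K\<close>.\<close>

lemma residual_neg_neighbor_unique:
  assumes "p \<in> residual W K" "d \<in> pos_dirs" "d' \<in> pos_dirs"
    and "shift p d (-1) \<in> residual W K" "shift p d' (-1) \<in> residual W K"
  shows "d = d'"
proof (rule ccontr)
  assume "d \<noteq> d'"
  obtain e where e: "e \<in> pos_dirs" "spare W K p = K - W (shift p e 1)"
    using spare_attained by blast
  obtain f where f: "f \<in> pos_dirs" "f \<noteq> e" "shift p f (-1) \<in> residual W K"
    using assms \<open>d \<noteq> d'\<close> by metis
  have "W p + W (shift p e 1) + W (shift p f (-1)) < 3 * K"
    using triangle e f by blast
  then show False
    using e f assms(1) by (auto simp: residual_def)
qed

text \<open>Otherwise the three cells form a triangle, and each weighs more than
  \<open>K\<close>.\<close>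

lemma residual_neighbors_opposite:
  assumes "p \<in> residual W K" "d \<in> pos_dirs" "d' \<in> pos_dirs"
    and "shift p d 1 \<in> residual W K" "shift p d' (-1) \<in> residual W K"
  shows "d = d'"
proof (rule ccontr)
  assume "d \<noteq> d'"
  then have "W p + W (shift p d 1) + W (shift p d' (-1)) < 3 * K"
    using triangle assms by blast
  moreover have "K < W p" "K < W (shift p d 1)" "K < W (shift p d' (-1))"
    using assms by (simp_all add: residual_def)
  ultimately show False
    by linarith
qed

lemma sum_run_length_eq:
  assumes "d \<in> pos_dirs"
    and "\<And>d'. d' \<in> pos_dirs \<Longrightarrow> shift p d' (-1) \<in> residual W K \<Longrightarrow> d' = d"
  shows "(\<Sum>d'\<in>pos_dirs. run_length (residual W K) d' p) = run_length (residual W K) d p"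
proof -
  have "run_length (residual W K) d' p = 0" if "d' \<in> pos_dirs - {d}" for d'
    using assms(2)[of d'] that by (intro run_length_eq_0) auto
  then show ?thesis
    using assms(1) by (simp add: sum.remove)
qed

text \<open>For both ends of a residual edge in direction \<open>d\<close>, only the run in
  direction \<open>d\<close> contributes to the sum: at the tail by
  \<open>residual_neighbors_opposite\<close>, at the head by
  \<open>residual_neg_neighbor_unique\<close>. This run grows by one along the edge, so the parity
  flips.\<close>

lemma side_neq:
  assumes "neighboring_cells p q" "p \<in> residual W K" "q \<in> residual W K"
  shows "side W K p \<noteq> side W K q"
proof -
  have "side W K p \<noteq> side W K (shift p d 1)"
    if d: "d \<in> pos_dirs" and p: "p \<in> residual W K" and q: "shift p d 1 \<in> residual W K" for p d
  proof -
    have "(\<Sum>d'\<in>pos_dirs. run_length (residual W K) d' p) = run_length (residual W K) d p"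
      using sum_run_length_eq residual_neighbors_opposite d p q by blast
    moreover have "(\<Sum>d'\<in>pos_dirs. run_length (residual W K) d' (shift p d 1))
        = run_length (residual W K) d (shift p d 1)"
      by (rule sum_run_length_eq)
        (use residual_neg_neighbor_unique[OF q _ d] d p in \<open>auto\<close>)
    ultimately show ?thesis
      using run_length_shift[OF finite_residual d p] by (simp add: side_def)
  qed
  then show ?thesis
    using assms by (metis neighboring_cells_iff)
qed

section \<open>Propriety of the offline coloring\<close>

lemma cell_color_bounds:
  assumes "j < W p"
  shows "0 < cell_color W K p j" "cell_color W K p j \<le> 4 * K"
proof -
  have "palette_color a i \<le> 4 * K" if "a < 4" "i < K" for a i
    using that unfolding palette_color_def by linarith
  moreover have "cell_class p < 4" "(cell_class p + 1) mod 3 < 4"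
    using cell_class_less[of p] by simp_all
  moreover have "spare W K p \<le> K"
    by (simp add: spare_def)
  ultimately show "cell_color W K p j \<le> 4 * K"
    using weight_le[of p] assms unfolding cell_color_def request_color_def by auto
  show "0 < cell_color W K p j"
    by (simp add: cell_color_def request_color_def palette_color_def)
qed

lemma cell_color_inj:
  assumes "i < W p" "j < W p" "cell_color W K p i = cell_color W K p j"
  shows "i = j"
proof -
  have "cell_class p < 3" "(cell_class p + 1) mod 3 < 3" "(cell_class p + 1) mod 3 \<noteq> cell_class p"
    using cell_class_less[of p] by simp_all presburger
  moreover have "spare W K p \<le> K"
    by (simp add: spare_def)
  ultimately show ?thesis
    using assms weight_le[of p] unfolding cell_color_def request_color_def
    by (auto simp: palette_color_inject split: if_splits)
qed

text \<open>The classes force \<open>q\<close> to be a positive neighbor of \<open>p\<close>. So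
  \<open>p\<close> borrows only indices from \<open>W q\<close> upwards, while \<open>q\<close>
  itself uses those below \<open>W q\<close>.\<close>

lemma own_neq_borrowed:
  assumes "neighboring_cells p q" "cell_class q = (cell_class p + 1) mod 3"
    and "j < W q" "K \<le> i" "i < K + spare W K p"
  shows "j \<noteq> K - 1 - (i - K)"
proof -
  have "\<exists>d\<in>pos_dirs. q = shift p d 1"
  proof (rule ccontr)
    assume "\<not> ?thesis"
    then obtain d where "d \<in> pos_dirs" "p = shift q d 1"
      using assms(1) by (auto simp: neighboring_cells_iff)
    then have "cell_class p = (cell_class q + 1) mod 3"
      by (simp add: cell_class_shift)
    then show False
      using assms(2) by presburger
  qed
  then have "spare W K p \<le> K - W q"
    using spare_le by blast
  then show ?thesis
    using assms by linarith
qed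

lemma cell_color_neq:
  assumes "neighboring_cells p q" "i < W p" "j < W q"
  shows "cell_color W K p i \<noteq> cell_color W K q j"
proof -
  define c where "c = cell_class p"
  define d where "d = cell_class q"
  define c' where "c' = (c + 1) mod 3"
  define d' where "d' = (d + 1) mod 3"
  have less: "c < 3" "d < 3" "c' < 3" "d' < 3"
    using cell_class_less by (simp_all add: c_def d_def c'_def d'_def)
  have "c \<noteq> d"
    using cell_class_neq_of_neighboring[OF assms(1)] by (simp add: c_def d_def)
  with less have "c' \<noteq> d'"
    unfolding c'_def d'_def by presburger
  have borrow_p: "j \<noteq> K - 1 - (i - K)" if "d = c'" "K \<le> i" "i < K + spare W K p"
    using own_neq_borrowed[OF assms(1)] assms that by (simp add: c_def d_def c'_def)
  have borrow_q: "i \<noteq> K - 1 - (j - K)" if "c = d'" "K \<le> j" "j < K + spare W K q"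
    using own_neq_borrowed[of q p] assms that
    by (simp add: c_def d_def d'_def neighboring_cells_sym)
  have color_p: "cell_color W K p i =
    (if i < K then palette_color c i
     else if i < K + spare W K p then palette_color c' (K - 1 - (i - K))
     else palette_color 3 (if side W K p then i - K - spare W K p
       else K - 1 - (i - K - spare W K p)))"
    by (simp add: cell_color_def request_color_def c_def c'_def)
  have color_q: "cell_color W K q j =
    (if j < K then palette_color d j
     else if j < K + spare W K q then palette_color d' (K - 1 - (j - K))
     else palette_color 3 (if side W K q then j - K - spare W K q
       else K - 1 - (j - K - spare W K q)))"
    by (simp add: cell_color_def request_color_def d_def d'_def)
  consider (fourth) "K + spare W K p \<le> i" "K + spare W K q \<le> j"
    | (base_p) "i < K + spare W K p" | (base_q) "j < K + spare W K q"
    by linarith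
  then show ?thesis
  proof cases
    \<comment> \<open>Both cells are residual, so one fills the fourth palette upwards and the other
      downwards. Together they need fewer than \<open>3 * K - 2 * K\<close> of its colors and do not
      meet.\<close>
    case fourth
    then have "side W K p \<noteq> side W K q"
      using side_neq assms by (auto simp: residual_def)
    then show ?thesis
      using fourth edge[OF assms(1)] assms unfolding color_p color_q
      by (auto simp: palette_color_inject)
  next
    \<comment> \<open>Two own colors differ by \<open>c \<noteq> d\<close>, two borrowed ones by
      \<open>c' \<noteq> d'\<close>; the mixed cases are \<open>borrow_p\<close> and
      \<open>borrow_q\<close>.\<close>
    case base_p
    then show ?thesis
      using less \<open>c \<noteq> d\<close> \<open>c' \<noteq> d'\<close> borrow_p borrow_q
      unfolding color_p color_q by (auto simp: palette_color_inject)
  next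
    case base_q
    then show ?thesis
      using less \<open>c \<noteq> d\<close> \<open>c' \<noteq> d'\<close> borrow_p borrow_q
      unfolding color_p color_q by (auto simp: palette_color_inject)
  qed
qed

end

section \<open>The optimum and cliques\<close>

lemma opt_attained:
  obtains cs where "proper_multicoloring G I cs" "card (set cs) = opt G I"
proof -
  have "proper_multicoloring G I (map Suc [0..<length I])"
    by (auto simp: proper_multicoloring_def)
  then have "\<exists>k cs. proper_multicoloring G I cs \<and> card (set cs) = k"
    by blast
  then have "\<exists>cs. proper_multicoloring G I cs \<and> card (set cs) = opt G I"
    unfolding opt_def by (rule LeastI_ex)
  then show ?thesis
    using that by blast
qed

text \<open>Requests to a clique get pairwise distinct colors. Adjacency is demanded of requested
  nodes only, because \<open>S\<close> will be the preimage of a triangle of cells and may contain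
  elements outside the graph.\<close>

lemma clique_requests_le_opt:
  assumes "\<And>u v. \<lbrakk>u \<in> S; v \<in> S; u \<in> set I; v \<in> set I\<rbrakk> \<Longrightarrow> u = v \<or> {u, v} \<in> snd G"
  shows "length (filter (\<lambda>v. v \<in> S) I) \<le> opt G I"
proof -
  obtain cs where cs: "proper_multicoloring G I cs" "card (set cs) = opt G I"
    using opt_attained by blast
  let ?P = "{i. i < length I \<and> I ! i \<in> S}"
  have "inj_on (nth cs) ?P"
  proof (rule linorder_inj_onI)
    fix i j assume "i < j" "i \<in> ?P" "j \<in> ?P"
    then show "cs ! i \<noteq> cs ! j"
      using cs(1) assms[of "I ! i" "I ! j"] by (auto simp: proper_multicoloring_def)
  qed auto
  moreover have "nth cs ` ?P \<subseteq> set cs"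
    using cs(1) by (auto simp: proper_multicoloring_def)
  ultimately have "card ?P \<le> card (set cs)"
    by (metis List.finite_set card_inj_on_le)
  then show ?thesis
    using cs(2) by (simp add: length_filter_conv_card)
qed

lemma count_list_triple:
  assumes "a \<noteq> b" "a \<noteq> c" "b \<noteq> c"
  shows "count_list xs a + count_list xs b + count_list xs c
    = length (filter (\<lambda>x. x \<in> {a, b, c}) xs)"
  using assms by (induction xs) auto

lemma neighboring_cells_neq: "neighboring_cells p q \<Longrightarrow> p \<noteq> q"
  by (auto simp: neighboring_cells_def)

definition hex_cells :: "'v graph \<Rightarrow> ('v \<Rightarrow> int \<times> int) \<Rightarrow> bool" where
  "hex_cells G cell \<longleftrightarrow> inj_on cell (fst G) \<and>
    snd G = {{u, v} | u v. u \<in> fst G \<and> v \<in> fst G \<and> neighboring_cells (cell u) (cell v)}"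

lemma hex_cells_edge_iff:
  assumes "hex_cells G cell" "u \<in> fst G" "v \<in> fst G"
  shows "{u, v} \<in> snd G \<longleftrightarrow> neighboring_cells (cell u) (cell v)"
proof
  assume "{u, v} \<in> snd G"
  then obtain a b where "{u, v} = {a, b}" "neighboring_cells (cell a) (cell b)"
    using assms(1) by (auto simp: hex_cells_def)
  then show "neighboring_cells (cell u) (cell v)"
    using neighboring_cells_sym by (metis doubleton_eq_iff)
qed (use assms in \<open>auto simp: hex_cells_def\<close>)

text \<open>The nodes placed in a triangle of cells form a clique, whose requests number at most
  \<open>opt G I\<close>.\<close>

lemma grid_weights_requests:
  assumes "hex_cells G cell" "I \<in> lists (fst G)"
  shows "grid_weights (count_list (map cell I)) (opt G I div 3 + 1)"
proof
  have "{p. count_list (map cell I) p \<noteq> 0} = set (map cell I)"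
    by (auto simp: count_list_0_iff)
  then show "finite {p. count_list (map cell I) p \<noteq> 0}"
    by (metis List.finite_set)
next
  fix p d d' assume d: "d \<in> pos_dirs" "d' \<in> pos_dirs" "d \<noteq> d'"
  let ?T = "{p, shift p d 1, shift p d' (-1)}"
  note nb = neighboring_cells_triangle[OF d, of p]
  have "length (filter (\<lambda>v. v \<in> {v. cell v \<in> ?T}) I) \<le> opt G I"
  proof (rule clique_requests_le_opt)
    fix u v assume uv: "u \<in> {v. cell v \<in> ?T}" "v \<in> {v. cell v \<in> ?T}" "u \<in> set I" "v \<in> set I"
    then have V: "u \<in> fst G" "v \<in> fst G"
      using assms(2) by auto
    have "cell u = cell v \<or> neighboring_cells (cell u) (cell v)"
      using uv nb by (auto simp: neighboring_cells_sym)
    moreover have "u = v" if "cell u = cell v"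
      using assms(1) V that by (auto simp: hex_cells_def dest: inj_onD)
    ultimately show "u = v \<or> {u, v} \<in> snd G"
      using hex_cells_edge_iff[OF assms(1) V] by blast
  qed
  moreover have "length (filter (\<lambda>v. v \<in> {v. cell v \<in> ?T}) I)
      = length (filter (\<lambda>x. x \<in> ?T) (map cell I))"
    by (simp add: filter_map comp_def)
  moreover have "count_list (map cell I) p + count_list (map cell I) (shift p d 1)
      + count_list (map cell I) (shift p d' (-1)) = length (filter (\<lambda>x. x \<in> ?T) (map cell I))"
    using nb by (intro count_list_triple neighboring_cells_neq)
  moreover have "opt G I < 3 * (opt G I div 3 + 1)"
    by simp
  ultimately show "count_list (map cell I) p + count_list (map cell I) (shift p d 1)
      + count_list (map cell I) (shift p d' (-1)) < 3 * (opt G I div 3 + 1)"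
    by linarith
qed

section \<open>The advice\<close>

text \<open>Rereading the whole prefix at every request is free, since only the largest index read
  counts.\<close>

primrec read_prefix :: "nat \<Rightarrow> (bool list \<Rightarrow> 'a) \<Rightarrow> 'a advised" where
  "read_prefix 0 f = Return (f [])"
| "read_prefix (Suc n) f = Read n (\<lambda>b. read_prefix n (\<lambda>bs. f (bs @ [b])))"

lemma run_read_prefix: "run \<phi> (read_prefix n f) = f (map \<phi> [0..<n])"
  by (induction n arbitrary: f) auto

lemma max_read_read_prefix: "max_read \<phi> (read_prefix n f) = n"
  by (induction n arbitrary: f) auto

definition lead :: "bool list \<Rightarrow> nat" where
  "lead bs = length (takeWhile Not bs)"

text \<open>
  The request bit that ends the first phase cannot also tell whether this request is borrowed, so
  the node bit \<open>b\<close> takes its place when the length of the second phase is determined. While that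
  phase lasts, \<open>m\<close> is only a lower bound on its length, which suffices.
\<close>

definition decode_color :: "nat \<Rightarrow> bool \<Rightarrow> bool \<Rightarrow> bool list \<Rightarrow> nat" where
  "decode_color c s b bs =
    (let k = lead bs; m = lead (b # drop (Suc k) bs) in request_color c s k m (length bs - 1))"

text \<open>The inequality, rather than an equation, makes the bit of request \<open>k + i\<close>
  equal to \<open>m \<le> i\<close> for every positive \<open>i\<close>, also when \<open>m\<close>
  is 0 and the second phase is empty.\<close>

definition switch_bit :: "nat \<Rightarrow> nat \<Rightarrow> nat \<Rightarrow> bool" where
  "switch_bit k m j \<longleftrightarrow> j = k \<or> k + m \<le> j"

lemma lead_map_upt:
  assumes "\<And>i. i < k \<Longrightarrow> \<not> f i" "f k"
  shows "lead (map f [0..<n]) = min k n"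
proof -
  have "takeWhile Not (map f [0..<n]) = take k (map f [0..<n])"
    by (rule takeWhile_eq_take_P_nth) (use assms in auto)
  then show ?thesis
    by (simp add: lead_def)
qed

text \<open>While a phase lasts, its decoded end lies just past request \<open>j\<close>. This
  selects the correct phase, and the color there does not depend on the true end.\<close>

lemma decode_color_switch_bits:
  "decode_color c s (m = 0) (map (switch_bit k m) [0..<Suc j]) = request_color c s k m j"
proof -
  have lead_k: "lead (map (switch_bit k m) [0..<Suc j]) = min k (Suc j)"
    by (rule lead_map_upt) (auto simp: switch_bit_def)
  show ?thesis
  proof (cases "j < k")
    case True
    then show ?thesis
      unfolding decode_color_def Let_def lead_k by (simp add: request_color_def)
  next
    case False
    \<comment> \<open>Entry \<open>i\<close> of this list belongs to request \<open>k + i\<close> of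
      the node; the node bit supplies entry 0.\<close>
    have "(m = 0) # drop (Suc k) (map (switch_bit k m) [0..<Suc j])
        = map (\<lambda>i. m \<le> i) [0..<Suc (j - k)]"
      by (rule nth_equalityI)
        (use False in \<open>auto simp: switch_bit_def nth_Cons split: nat.split simp del: upt_Suc\<close>)
    moreover have "lead (map (\<lambda>i. m \<le> i) [0..<Suc (j - k)]) = min m (Suc (j - k))"
      by (rule lead_map_upt) auto
    ultimately show ?thesis
      using False unfolding decode_color_def Let_def lead_k
      by (auto simp: request_color_def min_def simp del: upt_Suc)
  qed
qed

text \<open>Collecting the request bits of one node thus yields its bits in order of rank, without
  gaps.\<close>

lemma map_count_list_take_filter:
  "map (\<lambda>i. count_list (take i xs) x) (filter (\<lambda>i. xs ! i = x) [0..<length xs])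
    = [0..<count_list xs x]"
proof (induction xs rule: rev_induct)
  case (snoc y xs)
  have "filter (\<lambda>i. (xs @ [y]) ! i = x) [0..<length xs] = filter (\<lambda>i. xs ! i = x) [0..<length xs]"
    by (rule filter_cong) (auto simp: nth_append)
  moreover have "map (\<lambda>i. count_list (take i (xs @ [y])) x) (filter (\<lambda>i. xs ! i = x) [0..<length xs])
      = map (\<lambda>i. count_list (take i xs) x) (filter (\<lambda>i. xs ! i = x) [0..<length xs])"
    by (rule map_cong) auto
  ultimately show ?case
    using snoc by simp
qed simp

section \<open>The algorithm and its oracle\<close>

definition embedding :: "'v graph \<Rightarrow> 'v \<Rightarrow> int \<times> int" where
  "embedding G = (SOME cell. hex_cells G cell)"

definition numbering :: "'v graph \<Rightarrow> 'v \<Rightarrow> nat" where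
  "numbering G = (SOME h. bij_betw h (fst G) {0..<card (fst G)})"

lemma hex_cells_embedding:
  assumes "hexagonal_graph G"
  shows "hex_cells G (embedding G)"
proof -
  have "\<exists>cell. hex_cells G cell"
    using assms by (auto simp: hexagonal_graph_def hex_cells_def)
  then show ?thesis
    unfolding embedding_def by (rule someI_ex)
qed

lemma bij_betw_numbering:
  assumes "hexagonal_graph G"
  shows "bij_betw (numbering G) (fst G) {0..<card (fst G)}"
proof -
  have "\<exists>h. bij_betw h (fst G) {0..<card (fst G)}"
    using assms ex_bij_betw_finite_nat by (auto simp: hexagonal_graph_def)
  then show ?thesis
    unfolding numbering_def by (rule someI_ex)
qed

text \<open>Tape layout: two cells per node, ordered by \<open>numbering\<close>, then one cell per
  request. Both \<open>embedding\<close> and \<open>numbering\<close> are choices depending on the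
  graph alone, so the oracle makes the same ones.\<close>

definition hex_algorithm :: "'v online_algorithm" where
  "hex_algorithm G I = (let N = 2 * card (fst G); v = last I; a = 2 * numbering G v in
     read_prefix (N + length I) (\<lambda>bs.
       decode_color (cell_class (embedding G v)) (bs ! a) (bs ! Suc a)
         (map (\<lambda>i. bs ! (N + i)) (filter (\<lambda>i. I ! i = v) [0..<length I]))))"

definition hex_oracle :: "'v oracle_fun" where
  "hex_oracle G I t =
    (let N = 2 * card (fst G); W = count_list (map (embedding G) I); K = opt G I div 3 + 1 in
     if t < N then
       let p = embedding G (inv_into (fst G) (numbering G) (t div 2))
       in if even t then side W K p else spare W K p = 0
     else
       let v = I ! (t - N)
       in switch_bit K (spare W K (embedding G v)) (count_list (take (t - N) I) v))"

text \<open>The advice replaces the missing knowledge: a prefix of \<open>I\<close> suffices to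
  reproduce the offline coloring, which is defined from the final weights and the optimum.\<close>

lemma online_colors_hex:
  assumes G: "hexagonal_graph G" and I: "I \<in> lists (fst G)" and i: "i < length I"
  shows "online_colors hex_algorithm hex_oracle G I ! i
    = cell_color (count_list (map (embedding G) I)) (opt G I div 3 + 1)
        (embedding G (I ! i)) (count_list (take i I) (I ! i))"
proof -
  define N where "N = 2 * card (fst G)"
  define W where "W = count_list (map (embedding G) I)"
  define K where "K = opt G I div 3 + 1"
  define v where "v = I ! i"
  define p where "p = embedding G v"
  define a where "a = 2 * numbering G v"
  define J where "J = take (Suc i) I"
  define \<phi> where "\<phi> = hex_oracle G I"
  define bs where "bs = map \<phi> [0..<N + length J]"
  have vV: "v \<in> fst G"
    using I i by (auto simp: v_def)
  have lastJ: "last J = v"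
    using i by (simp add: J_def v_def take_Suc_conv_app_nth)
  have lenJ: "length J = Suc i"
    using i by (simp add: J_def)
  have "numbering G v < card (fst G)"
    using bij_betw_apply[OF bij_betw_numbering[OF G] vV] by simp
  then have aN: "Suc a < N"
    by (simp add: a_def N_def)
  have inv: "inv_into (fst G) (numbering G) (numbering G v) = v"
    using bij_betw_numbering[OF G] vV by (meson bij_betw_inv_into_left)
  have side: "bs ! a = side W K p"
    using aN inv unfolding bs_def \<phi>_def hex_oracle_def Let_def N_def[symmetric]
    by (simp add: a_def p_def W_def K_def)
  have flag: "bs ! Suc a = (spare W K p = 0)"
    using aN inv unfolding bs_def \<phi>_def hex_oracle_def Let_def N_def[symmetric]
    by (simp add: a_def p_def W_def K_def)
  \<comment> \<open>The oracle takes ranks in \<open>I\<close>, but a rank depends only on earlier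
    requests, which \<open>J\<close> contains.\<close>
  have bit: "bs ! (N + l) = switch_bit K (spare W K p) (count_list (take l J) v)"
    if "l < length J" "J ! l = v" for l
  proof -
    have "I ! l = v" "take l J = take l I"
      using that lenJ by (simp_all add: J_def min_def)
    then show ?thesis
      using that unfolding bs_def \<phi>_def hex_oracle_def Let_def N_def[symmetric]
      by (simp add: p_def W_def K_def)
  qed
  have "map (\<lambda>l. bs ! (N + l)) (filter (\<lambda>l. J ! l = v) [0..<length J])
      = map (switch_bit K (spare W K p))
          (map (\<lambda>l. count_list (take l J) v) (filter (\<lambda>l. J ! l = v) [0..<length J]))"
    using bit by auto
  also have "\<dots> = map (switch_bit K (spare W K p)) [0..<Suc (count_list (take i I) v)]"
    unfolding map_count_list_take_filter
    using i by (simp add: J_def v_def take_Suc_conv_app_nth)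
  finally have bits: "map (\<lambda>l. bs ! (N + l)) (filter (\<lambda>l. J ! l = v) [0..<length J])
      = map (switch_bit K (spare W K p)) [0..<Suc (count_list (take i I) v)]" .
  have "online_colors hex_algorithm hex_oracle G I ! i = run \<phi> (hex_algorithm G J)"
    using i by (simp add: online_colors_def \<phi>_def J_def)
  also have "\<dots> = decode_color (cell_class p) (bs ! a) (bs ! Suc a)
      (map (\<lambda>l. bs ! (N + l)) (filter (\<lambda>l. J ! l = v) [0..<length J]))"
    unfolding hex_algorithm_def Let_def run_read_prefix lastJ
    by (simp add: bs_def N_def a_def p_def)
  also have "\<dots> = cell_color W K p (count_list (take i I) v)"
    unfolding bits side flag decode_color_switch_bits cell_color_def ..
  finally show ?thesis
    by (simp add: W_def K_def p_def v_def)
qed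

section \<open>Correctness, number of colors and advice complexity\<close>

lemma count_list_map_inj_on:
  assumes "inj_on f A" "set xs \<subseteq> A" "x \<in> A"
  shows "count_list (map f xs) (f x) = count_list xs x"
  using assms by (induction xs) (auto dest: inj_onD)

lemma count_list_take_strict_mono:
  assumes "i < j" "j \<le> length xs"
  shows "count_list (take i xs) (xs ! i) < count_list (take j xs) (xs ! i)"
proof -
  have "take j xs = take i xs @ xs ! i # drop (Suc i) (take j xs)"
    using assms id_take_nth_drop[of i "take j xs"] by (simp add: min_def)
  then show ?thesis
    by (metis count_list_append count_list.simps(2) less_add_Suc1 add_Suc_right add.right_neutral Suc_eq_plus1)
qed

text \<open>Each request is identified with its cell and its rank there, which is below the weight
  of the cell; so the results on \<open>cell_color\<close> carry over.\<close>

lemma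
  assumes G: "hexagonal_graph G" and I: "I \<in> lists (fst G)"
  shows proper_multicoloring_hex:
      "proper_multicoloring G I (online_colors hex_algorithm hex_oracle G I)"
    and set_online_colors_hex:
      "set (online_colors hex_algorithm hex_oracle G I) \<subseteq> {1..4 * (opt G I div 3 + 1)}"
proof -
  let ?cs = "online_colors hex_algorithm hex_oracle G I" and ?cell = "embedding G"
  define W where "W = count_list (map ?cell I)"
  define K where "K = opt G I div 3 + 1"
  have cells: "hex_cells G ?cell"
    using G by (rule hex_cells_embedding)
  then interpret grid_weights W K
    unfolding W_def K_def using I by (rule grid_weights_requests)
  have len: "length ?cs = length I"
    by (simp add: online_colors_def)
  have color: "?cs ! i = cell_color W K (?cell (I ! i)) (count_list (take i I) (I ! i))"
    if "i < length I" for i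
    using online_colors_hex[OF G I that] by (simp add: W_def K_def)
  have V: "I ! i \<in> fst G" if "i < length I" for i
    using I that by auto
  have less: "count_list (take i I) (I ! i) < W (?cell (I ! i))" if "i < length I" for i
  proof -
    have "W (?cell (I ! i)) = count_list I (I ! i)"
      unfolding W_def using cells I V[OF that]
      by (intro count_list_map_inj_on[where A = "fst G"]) (auto simp: hex_cells_def)
    then show ?thesis
      using count_list_take_strict_mono[of i "length I" I] that by simp
  qed
  show "set ?cs \<subseteq> {1..4 * (opt G I div 3 + 1)}"
  proof
    fix x assume "x \<in> set ?cs"
    then obtain i where "i < length I" "x = ?cs ! i"
      using len by (metis in_set_conv_nth)
    then show "x \<in> {1..4 * (opt G I div 3 + 1)}"
      using cell_color_bounds[OF less] color unfolding K_def[symmetric] by (simp add: Suc_le_eq)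
  qed
  have "?cs ! i \<noteq> ?cs ! j"
    if ij: "i < j" "j < length I" and adj: "I ! i = I ! j \<or> {I ! i, I ! j} \<in> snd G" for i j
  proof (cases "I ! i = I ! j")
    case True
    have lt: "count_list (take i I) (I ! j) < count_list (take j I) (I ! j)"
      using count_list_take_strict_mono[of i j I] ij True by simp
    show ?thesis
    proof
      assume "?cs ! i = ?cs ! j"
      then have "cell_color W K (?cell (I ! j)) (count_list (take i I) (I ! j))
          = cell_color W K (?cell (I ! j)) (count_list (take j I) (I ! j))"
        using color[of i] color[of j] ij True by simp
      then have "count_list (take i I) (I ! j) = count_list (take j I) (I ! j)"
        using cell_color_inj[of _ "?cell (I ! j)"] less[of j] lt ij by simp
      with lt show False
        by simp
    qed
  next
    case False
    then have "neighboring_cells (?cell (I ! i)) (?cell (I ! j))"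
      using adj hex_cells_edge_iff[OF cells] V ij by simp
    then show ?thesis
      using cell_color_neq less color ij by simp
  qed
  then show "proper_multicoloring G I ?cs"
    using len color cell_color_bounds(1)[OF less] by (auto simp: proper_multicoloring_def)
qed

lemma advice_complexity_hex:
  "advice_complexity hex_algorithm hex_oracle G I \<le> length I + 2 * card (fst G)"
  by (auto simp: advice_complexity_def hex_algorithm_def Let_def max_read_read_prefix)

theorem theorem10:
  shows "\<exists>(A :: 'v online_algorithm) (orc :: 'v oracle_fun).
    multicolors {G. hexagonal_graph G} A orc \<and>
    competitive {G. hexagonal_graph G} (4 / 3) A orc \<and>
    (\<forall>V E I. hexagonal_graph (V, E) \<longrightarrow> I \<in> lists V \<longrightarrow>
       advice_complexity A orc (V, E) I \<le> length I + 2 * card V)"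
proof (intro exI conjI allI impI)
  show "multicolors {G. hexagonal_graph G} hex_algorithm (hex_oracle :: 'v oracle_fun)"
    by (simp add: multicolors_def proper_multicoloring_hex)
  \<comment> \<open>The additive constant 4 comes from the \<open>+ 1\<close> in the size of each of
    the four palettes.\<close>
  have "real (card (set (online_colors hex_algorithm hex_oracle G I))) \<le> 4 / 3 * real (opt G I) + 4"
    if "hexagonal_graph G" "I \<in> lists (fst G)" for G :: "'v graph" and I
  proof -
    have "card (set (online_colors hex_algorithm hex_oracle G I)) \<le> 4 * (opt G I div 3 + 1)"
      using card_mono[OF _ set_online_colors_hex[OF that]] by simp
    also have "\<dots> = 4 * (opt G I div 3) + 4"
      by simp
    finally have "3 * card (set (online_colors hex_algorithm hex_oracle G I)) \<le> 4 * opt G I + 12"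
      by linarith
    then have "real (3 * card (set (online_colors hex_algorithm hex_oracle G I)))
        \<le> real (4 * opt G I + 12)"
      by (rule of_nat_mono)
    then show ?thesis
      by simp
  qed
  then show "competitive {G. hexagonal_graph G} (4 / 3) hex_algorithm (hex_oracle :: 'v oracle_fun)"
    unfolding competitive_def by blast
  show "advice_complexity hex_algorithm hex_oracle (V, E) I \<le> length I + 2 * card V"
    for V E and I :: "'v list"
    using advice_complexity_hex[of "(V, E)" I] by simp
qed

end
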